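(* Let $V$ be a Euclidean Jordan algebra with unit element $e$ and symmetric cone $K$, and let $D$ be a skew-symmetric (that is, $D+D^T=0$) $Z$-transformation on $K$ (equivalently, $D$ is a derivation of $V$). Then the following are equivalent: (i) The game $(D,e)$ is completely mixed. (ii) $D$ is space-irreducible (relative to $K$). (iii) $\ker(D)$ is one dimensional.
   Context: A Euclidean Jordan algebra $(V,\circ,\langle\cdot,\cdot\rangle)$ is a finite dimensional real inner product space with a commutative bilinear product $\circ$ and unit element $e$ satisfying $x\circ(x^2\circ y)=x^2\circ(x\circ y)$ and $\langle x\circ y,z\rangle=\langle y,x\circ z\rangle$, where $x^2=x\circ x$. An idempotent is an element $c$ with $c^2=c$; it is primitive if it is nonzero and not a sum of two nonzero idempotents. A Jordan frame is a set $\{e_1,\dots,e_n\}$ of mutually orthogonal primitive idempotents with sum $e$. Every $x\in V$ can be written $x=x_1e_1+\cdots+x_ne_n$ with $\{e_1,\dots,e_n\}$ a Jordan frame and $x_i\in\mathbb{R}$; $\operatorname{tr}(x)=x_1+\cdots+x_n$. The inner product is assumed to be the trace inner product $\langle x,y\rangle=\operatorname{tr}(x\circ y)$. The symmetric cone is $K=\{x\circ x:x\in V\}$, with interior $K^\circ$; it is self-dual. $L^T$ denotes the transpose (adjoint) of $L$ with respect to the inner product. A linear transformation $L$ on $V$ is a $Z$-transformation on $K$ if $x,y\in K$, $\langle x,y\rangle=0$ imply $\langle L(x),y\rangle\le 0$. A derivation is a linear $D$ with $D(x\circ y)=D(x)\circ y+x\circ D(y)$ for all $x,y$; the skew-symmetric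 $Z$-transformations on $K$ are exactly the derivations of $V$ (a known fact). Linear game (with $e$ the unit element): let $\Delta(e)=\{x\in K:\langle x,e\rangle=1\}$. A pair $(\overline{x},\overline{y})\in\Delta(e)\times\Delta(e)$ is an optimal strategy pair for $(L,e)$ if $\langle L(x),\overline{y}\rangle\le\langle L(\overline{x}),\overline{y}\rangle\le\langle L(\overline{x}),y\rangle$ for all $x,y\in\Delta(e)$. The game $(L,e)$ is completely mixed if for every optimal strategy pair $(\overline{x},\overline{y})$ both $\overline{x},\overline{y}\in K^\circ$. A face of $K$ is a convex cone $F\subseteq K$ such that if $a\in F$ and $a=b+c$ with $b,c\in K$, then $b,c\in F$. $L$ is space-irreducible if whenever $F$ is a face of $K$ with $L(F-F)\subseteq F-F$, then $F=\{0\}$ or $F=K$; equivalently, for every idempotent $c$, $L(V(c,1))\subseteq V(c,1)$ implies $c=0$ or $c=e$, where $V(c,1)=\{x\in V:x\circ c=x\}$. *)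

theory Defs
  imports "HOL-Analysis.Analysis"
begin

text \<open>
  The algebra \<open>V\<close> is a type of class \<open>euclidean_space\<close>, i.e. a finite-dimensional real inner
  product space that is not \<open>{0}\<close>; the Jordan product and the unit element are parameters.
\<close>

locale euclidean_jordan_algebra =
  fixes jp :: "'a::euclidean_space \<Rightarrow> 'a \<Rightarrow> 'a" (infixl "\<odot>" 70)
    and e :: 'a
  assumes jp_bilinear: "bilinear (\<odot>)"
    and jp_commute: "x \<odot> y = y \<odot> x"
    and jp_unit: "e \<odot> x = x"
    and jp_jordan: "x \<odot> ((x \<odot> x) \<odot> y) = (x \<odot> x) \<odot> (x \<odot> y)"
    and jp_associative_inner: "inner (x \<odot> y) z = inner y (x \<odot> z)"

context
  fixes jp :: "'a::euclidean_space \<Rightarrow> 'a \<Rightarrow> 'a" (infixl "\<odot>" 70)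
begin

definition idempotent :: "'a \<Rightarrow> bool" where
  "idempotent c \<longleftrightarrow> c \<odot> c = c"

definition primitive_idempotent :: "'a \<Rightarrow> bool" where
  "primitive_idempotent c \<longleftrightarrow> idempotent c \<and> c \<noteq> 0 \<and>
     \<not> (\<exists>a b. idempotent a \<and> idempotent b \<and> a \<noteq> 0 \<and> b \<noteq> 0 \<and> c = a + b)"

definition jordan_frame :: "'a \<Rightarrow> 'a set \<Rightarrow> bool" where
  "jordan_frame e C \<longleftrightarrow> finite C \<and> (\<forall>c\<in>C. primitive_idempotent c) \<and>
     pairwise (\<lambda>c d. c \<odot> d = 0) C \<and> \<Sum>C = e"

text \<open>
  In a Euclidean Jordan algebra every element has a spectral decomposition, and the sum of the
  coefficients does not depend on the decomposition chosen.
\<close>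
definition jtrace :: "'a \<Rightarrow> 'a \<Rightarrow> real" where
  "jtrace e x = (THE t. \<exists>C r. jordan_frame e C \<and> x = (\<Sum>c\<in>C. r c *\<^sub>R c) \<and> t = (\<Sum>c\<in>C. r c))"

definition symmetric_cone :: "'a set" where
  "symmetric_cone = {x \<odot> x | x. True}"

end

definition Z_transformation :: "'a::euclidean_space set \<Rightarrow> ('a \<Rightarrow> 'a) \<Rightarrow> bool" where
  "Z_transformation K L \<longleftrightarrow> linear L \<and>
     (\<forall>x\<in>K. \<forall>y\<in>K. inner x y = 0 \<longrightarrow> inner (L x) y \<le> 0)"

definition strategies :: "'a::euclidean_space set \<Rightarrow> 'a \<Rightarrow> 'a set" where
  "strategies K e = {x \<in> K. inner x e = 1}"

definition optimal_strategy_pair ::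
    "'a::euclidean_space set \<Rightarrow> ('a \<Rightarrow> 'a) \<Rightarrow> 'a \<Rightarrow> 'a \<Rightarrow> 'a \<Rightarrow> bool" where
  "optimal_strategy_pair K L e x0 y0 \<longleftrightarrow>
     x0 \<in> strategies K e \<and> y0 \<in> strategies K e \<and>
     (\<forall>x\<in>strategies K e. \<forall>y\<in>strategies K e.
        inner (L x) y0 \<le> inner (L x0) y0 \<and> inner (L x0) y0 \<le> inner (L x0) y)"

definition completely_mixed :: "'a::euclidean_space set \<Rightarrow> ('a \<Rightarrow> 'a) \<Rightarrow> 'a \<Rightarrow> bool" where
  "completely_mixed K L e \<longleftrightarrow>
     (\<forall>x0 y0. optimal_strategy_pair K L e x0 y0 \<longrightarrow> x0 \<in> interior K \<and> y0 \<in> interior K)"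

text \<open>
  \<open>convex_cone\<close> requires nonemptiness. This matters: the empty set would otherwise be a face
  falsifying space-irreducibility of every map.
\<close>
definition cone_face :: "'a::euclidean_space set \<Rightarrow> 'a set \<Rightarrow> bool" where
  "cone_face K F \<longleftrightarrow> convex_cone F \<and> F \<subseteq> K \<and>
     (\<forall>a\<in>F. \<forall>b\<in>K. \<forall>c\<in>K. a = b + c \<longrightarrow> b \<in> F \<and> c \<in> F)"

definition space_irreducible :: "'a::euclidean_space set \<Rightarrow> ('a \<Rightarrow> 'a) \<Rightarrow> bool" where
  "space_irreducible K L \<longleftrightarrow>
     (\<forall>F. cone_face K F \<and> L ` {a - b | a b. a \<in> F \<and> b \<in> F} \<subseteq> {a - b | a b. a \<in> F \<and> b \<in> F}
        \<longrightarrow> F = {0} \<or> F = K)"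

end

theory Submission
  imports Defs
begin

text \<open>
  Write \<open>K\<close> for the cone of squares. Two properties of the algebra carry the proof. First, \<open>K\<close>
  is self-dual (\<open>self_dual\<close>). Second, every \<open>u\<close> has a least eigenvalue \<open>\<mu>\<close>, witnessed by an
  idempotent \<open>c\<close>: \<open>u - \<mu> e\<close> lies in \<open>K\<close> and is orthogonal to \<open>c\<close> (\<open>least_eigenvalue\<close>). Both
  come from the spectral decomposition, which is obtained here by splitting \<open>e\<close> into eigenvectors
  of multiplication by \<open>x\<close> within the span of the powers of \<open>x\<close>: these are automatically orthogonal
  idempotents (\<open>spectral_decomposition\<close>).

  About \<open>D\<close>, two facts suffice. A complementary pair \<open>c\<close>, \<open>e - c\<close> of idempotents is
  orthogonal, so that the \<open>Z\<close>-property forces \<open>D e\<close> to be orthogonal to every idempotent; as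
  idempotents span the algebra, \<open>D e = 0\<close>. And the resolvent \<open>(I + D)\<^sup>-\<^sup>1\<close> maps \<open>K\<close> into itself (\<open>resolvent_nonneg\<close>). It takes
  the role that the automorphisms \<open>exp (t D)\<close> of \<open>K\<close> have in the usual arguments.

  Since \<open>D e = 0\<close>, the game has value \<open>0\<close>, and the optimal strategies are exactly the strategies in
  \<open>ker D\<close>. If \<open>ker D\<close> is the line through \<open>e\<close>, they are multiples of \<open>e\<close> and so interior. If it
  is larger, subtracting from some \<open>u \<in> ker D\<close> its least eigenvalue times \<open>e\<close> gives a nonzero
  boundary point \<open>x\<close> of \<open>K\<close> in \<open>ker D\<close>, and \<open>x\<close>, once normalised, is an optimal strategy.

  For irreducibility, the face generated by such an \<open>x\<close> is proper and is preserved by the resolvent,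
  so that its span is invariant under \<open>D\<close>. Conversely, if the span \<open>W\<close> of a face is invariant, then
  so is its orthogonal complement, because \<open>D\<close> is skew. Therefore \<open>D\<close> annihilates the orthogonal
  projection of \<open>e\<close> on \<open>W\<close>. When \<open>ker D\<close> is the line through \<open>e\<close>, that projection is \<open>0\<close> or
  \<open>e\<close> itself, and the face is \<open>{0}\<close> or \<open>K\<close>.
\<close>

section \<open>Self-adjoint operators on an invariant subspace\<close>

text \<open>
  A maximiser of the Rayleigh quotient is an eigenvector: the form \<open>M \<bar>w\<bar>\<^sup>2 - \<langle>T w, w\<rangle>\<close> is
  positive semidefinite and vanishes at the maximiser, so the maximiser lies in its radical.
\<close>
lemma selfadjoint_has_eigenvector:
  fixes T :: "'a::euclidean_space \<Rightarrow> 'a"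
  assumes T: "linear T" and S: "subspace S" "S \<noteq> {0}"
    and inv: "\<And>x. x \<in> S \<Longrightarrow> T x \<in> S"
    and sa: "\<And>x y. x \<in> S \<Longrightarrow> y \<in> S \<Longrightarrow> inner (T x) y = inner x (T y)"
  obtains y M where "y \<in> S" "norm y = 1" "T y = M *\<^sub>R y"
proof -
  interpret T: linear T by fact
  have "compact (sphere 0 1 \<inter> S)"
    using S by (intro compact_Int_closed closed_subspace) auto
  moreover have "sphere 0 1 \<inter> S \<noteq> {}"
  proof -
    obtain a where a: "a \<in> S" "a \<noteq> 0" using S subspace_0 by blast
    then have "(1 / norm a) *\<^sub>R a \<in> sphere 0 1 \<inter> S"
      using S by (simp add: subspace_scale)
    then show ?thesis by blast
  qed
  moreover have "continuous_on (sphere 0 1 \<inter> S) (\<lambda>w. inner (T w) w)"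
    using T by (intro continuous_on_inner continuous_on_id linear_continuous_on)
      (simp add: linear_conv_bounded_linear)
  ultimately have "\<exists>y\<in>sphere 0 1 \<inter> S. \<forall>w\<in>sphere 0 1 \<inter> S. inner (T w) w \<le> inner (T y) y"
    by (rule continuous_attains_sup)
  then obtain y where y: "y \<in> sphere 0 1 \<inter> S"
    and mx: "\<And>w. w \<in> sphere 0 1 \<inter> S \<Longrightarrow> inner (T w) w \<le> inner (T y) y"
    by blast
  define M where "M = inner (T y) y"
  have yS: "y \<in> S" and ny: "norm y = 1" using y by auto
  have psd: "inner (T w) w \<le> M * inner w w" if "w \<in> S" for w
  proof (cases "w = 0")
    case False
    define v where "v = (1 / norm w) *\<^sub>R w"
    have w: "w = norm w *\<^sub>R v" using False by (simp add: v_def)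
    have "inner (T v) v \<le> M"
      unfolding M_def using False that S by (intro mx) (simp add: v_def subspace_scale)
    then have "(norm w)\<^sup>2 * inner (T v) v \<le> (norm w)\<^sup>2 * M"
      by (simp add: mult_left_mono)
    moreover have "inner (T w) w = (norm w)\<^sup>2 * inner (T v) v"
      by (subst (1 2) w) (simp add: T.scaleR power2_eq_square)
    ultimately show ?thesis by (simp add: power2_norm_eq_inner mult.commute)
  qed simp
  define g where "g = M *\<^sub>R y - T y"
  have gS: "g \<in> S" using S yS inv by (simp add: g_def subspace_diff subspace_scale)
  define b where "b = M * inner g g - inner (T g) g"
  have b: "b \<ge> 0" using psd[OF gS] by (simp add: b_def)
  \<comment> \<open>Evaluate the form at \<open>y + t g\<close>, where \<open>g\<close> is the defect; its linear term is \<open>2 t \<bar>g\<bar>\<^sup>2\<close>.\<close>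
  have q: "0 \<le> 2 * t * inner g g + t\<^sup>2 * b" for t
  proof -
    have 1: "inner (T (y + t *\<^sub>R g)) (y + t *\<^sub>R g) \<le> M * inner (y + t *\<^sub>R g) (y + t *\<^sub>R g)"
      using S yS gS by (intro psd) (simp add: subspace_add subspace_scale)
    have 2: "inner (T g) y = inner g (T y)" using sa gS yS by simp
    have 3: "inner (T y) y = M * inner y y" using ny by (simp add: M_def norm_eq_1)
    have 4: "inner (T (y + t *\<^sub>R g)) (y + t *\<^sub>R g)
        = inner (T y) y + t * inner (T y) g + t * inner (T g) y + t\<^sup>2 * inner (T g) g"
      by (simp add: T.add T.scaleR inner_add_left inner_add_right power2_eq_square
          distrib_left)
    have 5: "inner (y + t *\<^sub>R g) (y + t *\<^sub>R g) = inner y y + 2 * (t * inner g y) + t\<^sup>2 * inner g g"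
      by (simp add: inner_add_left inner_add_right inner_commute[of y g] power2_eq_square
          distrib_left)
    have 6: "inner g g = M * inner g y - inner g (T y)"
      by (subst (2) g_def) (simp add: inner_diff_right)
    show ?thesis
      using 1 unfolding 4 5 2 3 6[symmetric] b_def inner_commute[of "T y" g]
      using arg_cong[OF 6, of "\<lambda>r. 2 * t * r"] by (simp add: algebra_simps)
  qed
  have "inner g g = 0"
  proof (rule ccontr)
    assume "inner g g \<noteq> 0"
    then have g: "inner g g > 0" by simp
    \<comment> \<open>Minimising the quadratic would ask for \<open>b\<close> as denominator, but \<open>b\<close> may be \<open>0\<close>.\<close>
    define t where "t = - inner g g / (b + 1)"
    have "t * (b + 1) = - inner g g" using b by (simp add: t_def)
    moreover have "t < 0" using g b by (simp add: t_def divide_neg_pos)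
    moreover have "t\<^sup>2 * b = t * (t * (b + 1)) - t\<^sup>2"
      by (simp add: power2_eq_square algebra_simps)
    ultimately have "2 * t * inner g g + t\<^sup>2 * b = t * inner g g - t\<^sup>2" by simp
    moreover have "t * inner g g < 0" using \<open>t < 0\<close> g by (simp add: mult_neg_pos)
    ultimately show False using q[of t] by (smt (verit) zero_le_power2)
  qed
  then have "T y = M *\<^sub>R y" by (simp add: g_def)
  with yS ny that show ?thesis by blast
qed

text \<open>
  Indexing the summands by their eigenvalue ensures that different summands belong to different
  eigenvalues. The induction splits off one eigenvector and passes to its orthogonal complement.
\<close>
lemma selfadjoint_eigenvector_sum:
  fixes T :: "'a::euclidean_space \<Rightarrow> 'a"
  assumes T: "linear T" and "subspace S"
    and "\<And>x. x \<in> S \<Longrightarrow> T x \<in> S"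
    and "\<And>x y. x \<in> S \<Longrightarrow> y \<in> S \<Longrightarrow> inner (T x) y = inner x (T y)"
    and "x \<in> S"
  shows "\<exists>\<Lambda> u. finite \<Lambda> \<and> (\<forall>\<nu>\<in>\<Lambda>. u \<nu> \<in> S \<and> T (u \<nu>) = \<nu> *\<^sub>R u \<nu>) \<and> x = (\<Sum>\<nu>\<in>\<Lambda>. u \<nu>)"
  using assms(2-)
proof (induction "dim S" arbitrary: S x rule: less_induct)
  case less
  interpret T: linear T by fact
  show ?case
  proof (cases "S = {0}")
    case True
    then show ?thesis using less.prems by (intro exI[of _ "{}"]) auto
  next
    case False
    then obtain y M where y: "y \<in> S" "norm y = 1" "T y = M *\<^sub>R y"
      using selfadjoint_has_eigenvector[OF T less.prems(1) False less.prems(2,3)] by blast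
    define S' where "S' = {w \<in> S. inner y w = 0}"
    have sub: "subspace S'"
      using less.prems(1) by (auto simp: S'_def subspace_def inner_add_right)
    have yy: "inner y y = 1" using y by (simp add: norm_eq_1)
    have "y \<notin> S'" using yy by (simp add: S'_def)
    moreover have "S' \<subseteq> S" by (auto simp: S'_def)
    ultimately have "S' \<subset> S" using y(1) by blast
    then have "dim S' < dim S"
      using sub less.prems(1) by (metis dim_psubset span_eq_iff)
    moreover have "T w \<in> S'" if "w \<in> S'" for w
      using that y less.prems(2) less.prems(3)[of y w] by (auto simp: S'_def)
    moreover have "inner (T v) w = inner v (T w)" if "v \<in> S'" "w \<in> S'" for v w
      using that less.prems(3) by (auto simp: S'_def)
    moreover have "x - inner y x *\<^sub>R y \<in> S'"
      using y yy less.prems(1,4)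
      by (auto simp: S'_def subspace_diff subspace_scale inner_diff_right)
    ultimately obtain \<Lambda> u where u: "finite \<Lambda>" "\<forall>\<nu>\<in>\<Lambda>. u \<nu> \<in> S' \<and> T (u \<nu>) = \<nu> *\<^sub>R u \<nu>"
      "x - inner y x *\<^sub>R y = (\<Sum>\<nu>\<in>\<Lambda>. u \<nu>)"
      using less.hyps[of S' "x - inner y x *\<^sub>R y"] sub by blast
    \<comment> \<open>\<open>M\<close> may occur in \<open>\<Lambda>\<close> already; its two components are then merged.\<close>
    define u' where
      "u' \<nu> = (if \<nu> \<in> \<Lambda> then u \<nu> else 0) + (if \<nu> = M then inner y x *\<^sub>R y else 0)" for \<nu>
    have "(\<Sum>\<nu>\<in>insert M \<Lambda>. u' \<nu>) = (\<Sum>\<nu>\<in>\<Lambda>. u \<nu>) + inner y x *\<^sub>R y"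
    proof -
      have "(\<Sum>\<nu>\<in>insert M \<Lambda>. if \<nu> \<in> \<Lambda> then u \<nu> else 0) = (\<Sum>\<nu>\<in>\<Lambda>. u \<nu>)"
        using u(1) by (intro sum.mono_neutral_cong_right) auto
      moreover have "(\<Sum>\<nu>\<in>insert M \<Lambda>. if \<nu> = M then inner y x *\<^sub>R y else 0) = inner y x *\<^sub>R y"
        using u(1) by (subst sum.delta) auto
      ultimately show ?thesis by (simp only: u'_def sum.distrib)
    qed
    then have "x = (\<Sum>\<nu>\<in>insert M \<Lambda>. u' \<nu>)" using u(3) by (simp add: algebra_simps)
    moreover have "u' \<nu> \<in> S \<and> T (u' \<nu>) = \<nu> *\<^sub>R u' \<nu>" for \<nu>
      using u(2) y less.prems(1)
      by (auto simp: u'_def S'_def T.add T.scaleR T.zero subspace_add subspace_scale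
          subspace_0 scaleR_add_right)
    ultimately show ?thesis using u(1) by (intro exI[of _ "insert M \<Lambda>"] exI[of _ u']) auto
  qed
qed

section \<open>The span of a convex cone\<close>

lemma subspace_differences:
  fixes F :: "'a::real_vector set"
  assumes "convex_cone F"
  shows "subspace {a - b | a b. a \<in> F \<and> b \<in> F}" (is "subspace ?W")
proof -
  have F: "0 \<in> F" "\<And>x y. x \<in> F \<Longrightarrow> y \<in> F \<Longrightarrow> x + y \<in> F"
    "\<And>x t. x \<in> F \<Longrightarrow> t \<ge> 0 \<Longrightarrow> t *\<^sub>R x \<in> F"
    using assms by (auto simp: convex_cone_iff)
  show ?thesis
  proof (rule subspaceI)
    show "0 \<in> ?W" using F(1) by force
  next
    fix x y assume "x \<in> ?W" "y \<in> ?W"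
    then obtain a b a' b' where "x = a - b" "y = a' - b'" "a \<in> F" "b \<in> F" "a' \<in> F" "b' \<in> F"
      by blast
    moreover from this have "x + y = (a + a') - (b + b')" by simp
    ultimately show "x + y \<in> ?W" using F(2) by blast
  next
    fix t x assume "x \<in> ?W"
    then obtain a b where x: "x = a - b" "a \<in> F" "b \<in> F" by blast
    show "t *\<^sub>R x \<in> ?W"
    proof (cases "t \<ge> 0")
      case True
      moreover have "t *\<^sub>R x = t *\<^sub>R a - t *\<^sub>R b" by (simp add: x scaleR_diff_right)
      ultimately show ?thesis using F(3) x by blast
    next
      case False
      then have "- t \<ge> 0" by simp
      moreover have "t *\<^sub>R x = (- t) *\<^sub>R b - (- t) *\<^sub>R a" by (simp add: x scaleR_diff_right)
      ultimately show ?thesis using F(3) x by blast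
    qed
  qed
qed

section \<open>Operator-commuting powers\<close>

context euclidean_jordan_algebra
begin

abbreviation "K \<equiv> symmetric_cone (\<odot>)"

lemmas jp_distribs =
  bilinear_ladd[OF jp_bilinear] bilinear_radd[OF jp_bilinear]
  bilinear_lsub[OF jp_bilinear] bilinear_rsub[OF jp_bilinear]
  bilinear_lmul[OF jp_bilinear] bilinear_rmul[OF jp_bilinear]
  bilinear_lzero[OF jp_bilinear] bilinear_rzero[OF jp_bilinear]
  bilinear_lneg[OF jp_bilinear] bilinear_rneg[OF jp_bilinear]

lemma linear_jp: "linear ((\<odot>) a)"
  using jp_bilinear by (simp add: bilinear_def)

lemma linear_jp_left: "linear (\<lambda>a. a \<odot> b)"
  using jp_bilinear by (simp add: bilinear_def)

lemma jp_unit_right [simp]: "x \<odot> e = x"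
  by (subst jp_commute) (rule jp_unit)

lemma inner_jp_swap: "inner (a \<odot> b) c = inner a (b \<odot> c)"
  by (subst jp_commute) (rule jp_associative_inner)

lemma inner_square_unit: "inner (x \<odot> x) e = inner x x"
  by (simp add: inner_jp_swap)

lemma jordan_identity_linearised:
  "z \<odot> ((x \<odot> x) \<odot> y) + 2 *\<^sub>R (x \<odot> ((x \<odot> z) \<odot> y))
    = (x \<odot> x) \<odot> (z \<odot> y) + 2 *\<^sub>R ((x \<odot> z) \<odot> (x \<odot> y))" (is "?l = ?r")
proof -
  define F where "F x = x \<odot> ((x \<odot> x) \<odot> y) - (x \<odot> x) \<odot> (x \<odot> y)" for x
  have F0: "F x = 0" for x by (simp add: F_def jp_jordan)
  \<comment> \<open>\<open>F\<close> is cubic, and its odd part isolates the terms of degree one in \<open>z\<close> up to \<open>F z\<close>.\<close>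
  have "F (x + z) - F (x - z) = 2 *\<^sub>R (?l - ?r) + 2 *\<^sub>R F z"
    unfolding F_def
    by (simp add: jp_distribs jp_commute[of z x] algebra_simps scaleR_2)
  then show ?thesis by (simp add: F0)
qed

lemma jordan_identity_fully_linearised:
  "z \<odot> ((x \<odot> w) \<odot> y) + x \<odot> ((w \<odot> z) \<odot> y) + w \<odot> ((x \<odot> z) \<odot> y)
    = (x \<odot> w) \<odot> (z \<odot> y) + (x \<odot> z) \<odot> (w \<odot> y) + (w \<odot> z) \<odot> (x \<odot> y)" (is "?l = ?r")
proof -
  define F where "F x = z \<odot> ((x \<odot> x) \<odot> y) + 2 *\<^sub>R (x \<odot> ((x \<odot> z) \<odot> y))
    - ((x \<odot> x) \<odot> (z \<odot> y) + 2 *\<^sub>R ((x \<odot> z) \<odot> (x \<odot> y)))" for x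
  have F0: "F x = 0" for x by (simp add: F_def jordan_identity_linearised)
  have "F (x + w) - F x - F w = 2 *\<^sub>R (?l - ?r)"
    unfolding F_def
    by (simp add: jp_distribs jp_commute[of w x] algebra_simps scaleR_2)
  then show ?thesis by (simp add: F0)
qed

text \<open>
  Reading the fully linearised identity as a formula in the argument \<open>z\<close> expresses multiplication by
  a triple product through multiplications by products of at most two factors.
\<close>
lemma triple_product_operator:
  "(y \<odot> (x \<odot> w)) \<odot> z
    = (x \<odot> w) \<odot> (y \<odot> z) + (w \<odot> y) \<odot> (x \<odot> z) + (x \<odot> y) \<odot> (w \<odot> z)
      - x \<odot> (y \<odot> (w \<odot> z)) - w \<odot> (y \<odot> (x \<odot> z))"
proof -
  have "z \<odot> ((x \<odot> w) \<odot> y) = (y \<odot> (x \<odot> w)) \<odot> z"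
    "x \<odot> ((w \<odot> z) \<odot> y) = x \<odot> (y \<odot> (w \<odot> z))"
    "w \<odot> ((x \<odot> z) \<odot> y) = w \<odot> (y \<odot> (x \<odot> z))"
    "(x \<odot> w) \<odot> (z \<odot> y) = (x \<odot> w) \<odot> (y \<odot> z)"
    "(x \<odot> z) \<odot> (w \<odot> y) = (w \<odot> y) \<odot> (x \<odot> z)"
    "(w \<odot> z) \<odot> (x \<odot> y) = (x \<odot> y) \<odot> (w \<odot> z)"
    by (simp_all only: jp_commute)
  then show ?thesis
    using jordan_identity_fully_linearised[of z x w y] by (simp add: algebra_simps)
qed

definition operator_commute :: "'a \<Rightarrow> 'a \<Rightarrow> bool" where
  "operator_commute a b \<longleftrightarrow> (\<forall>z. a \<odot> (b \<odot> z) = b \<odot> (a \<odot> z))"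

definition jordan_power :: "'a \<Rightarrow> nat \<Rightarrow> 'a" where
  "jordan_power x n = (((\<odot>) x) ^^ n) e"

text \<open>
  By the triple product formula, multiplication by \<open>x\<^bsup>n+2\<^esup>\<close> is a polynomial in the multiplications
  by \<open>x\<close>, \<open>x\<^sup>2\<close>, \<open>x\<^sup>n\<close> and \<open>x\<^bsup>n+1\<^esup>\<close>; by induction all of them commute with those by \<open>x\<close> and \<open>x\<^sup>2\<close>,
  which commute with each other by the Jordan identity.
\<close>
lemma operator_commute_power:
  "operator_commute x (jordan_power x n) \<and> operator_commute (x \<odot> x) (jordan_power x n)"
proof (induction n rule: less_induct)
  case (less n)
  consider "n = 0" | "n = 1" | m where "n = Suc (Suc m)"
    by (metis One_nat_def not0_implies_Suc)
  then show ?case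
  proof cases
    case 1
    then show ?thesis by (simp add: operator_commute_def jordan_power_def jp_unit)
  next
    case 2
    then show ?thesis by (simp add: operator_commute_def jordan_power_def jp_jordan)
  next
    case 3
    define w where "w = jordan_power x m"
    have n: "jordan_power x n = x \<odot> (x \<odot> w)"
      by (simp add: 3 w_def jordan_power_def)
    have w: "operator_commute x w" "operator_commute (x \<odot> x) w"
      using less[of m] 3 by (auto simp: w_def)
    have xw: "operator_commute x (x \<odot> w)" "operator_commute (x \<odot> x) (x \<odot> w)"
      using less[of "Suc m"] 3 by (auto simp: w_def jordan_power_def)
    have step: "operator_commute a (x \<odot> (x \<odot> w))"
      if "operator_commute a x" "operator_commute a (x \<odot> x)"
        "operator_commute a w" "operator_commute a (x \<odot> w)" for a
    proof -
      have "a \<odot> (x \<odot> z) = x \<odot> (a \<odot> z)" "a \<odot> ((x \<odot> x) \<odot> z) = (x \<odot> x) \<odot> (a \<odot> z)"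
        "a \<odot> (w \<odot> z) = w \<odot> (a \<odot> z)" "a \<odot> ((x \<odot> w) \<odot> z) = (x \<odot> w) \<odot> (a \<odot> z)" for z
        using that by (auto simp: operator_commute_def)
      then show ?thesis
        unfolding operator_commute_def triple_product_operator[of x x w]
        by (simp add: jp_distribs jp_commute[of w x])
    qed
    show ?thesis unfolding n
      using w xw by (intro conjI step) (auto simp: operator_commute_def jp_jordan)
  qed
qed

lemma operator_commute_span_powers:
  assumes "b \<in> span (range (jordan_power x))"
  shows "operator_commute x b"
proof -
  have "subspace {b. operator_commute x b}"
    by (auto simp: subspace_def operator_commute_def jp_distribs)
  then have "span (range (jordan_power x)) \<subseteq> {b. operator_commute x b}"
    using operator_commute_power by (intro span_minimal) auto
  then show ?thesis using assms by blast
qed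

section \<open>Spectral decomposition\<close>

definition spectral_family :: "'a \<Rightarrow> real set \<Rightarrow> (real \<Rightarrow> 'a) \<Rightarrow> bool" where
  "spectral_family x \<Lambda> c \<longleftrightarrow> finite \<Lambda> \<and>
     (\<forall>\<nu>\<in>\<Lambda>. c \<nu> \<noteq> 0 \<and> c \<nu> \<odot> c \<nu> = c \<nu> \<and> x \<odot> c \<nu> = \<nu> *\<^sub>R c \<nu>) \<and>
     (\<forall>\<nu>\<in>\<Lambda>. \<forall>\<mu>\<in>\<Lambda>. \<nu> \<noteq> \<mu> \<longrightarrow> c \<nu> \<odot> c \<mu> = 0) \<and>
     e = (\<Sum>\<nu>\<in>\<Lambda>. c \<nu>) \<and> x = (\<Sum>\<nu>\<in>\<Lambda>. \<nu> *\<^sub>R c \<nu>)"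

lemma spectral_familyD:
  assumes "spectral_family x \<Lambda> c"
  shows "finite \<Lambda>" "\<And>\<nu>. \<nu> \<in> \<Lambda> \<Longrightarrow> c \<nu> \<noteq> 0"
    "\<And>\<nu>. \<nu> \<in> \<Lambda> \<Longrightarrow> c \<nu> \<odot> c \<nu> = c \<nu>" "\<And>\<nu>. \<nu> \<in> \<Lambda> \<Longrightarrow> x \<odot> c \<nu> = \<nu> *\<^sub>R c \<nu>"
    "\<And>\<nu> \<mu>. \<nu> \<in> \<Lambda> \<Longrightarrow> \<mu> \<in> \<Lambda> \<Longrightarrow> \<nu> \<noteq> \<mu> \<Longrightarrow> c \<nu> \<odot> c \<mu> = 0"
    "e = (\<Sum>\<nu>\<in>\<Lambda>. c \<nu>)" "x = (\<Sum>\<nu>\<in>\<Lambda>. \<nu> *\<^sub>R c \<nu>)"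
  using assms unfolding spectral_family_def by (elim conjE; (assumption | simp))+

text \<open>
  Multiplication by \<open>x\<close> is self-adjoint and preserves the span of the powers of \<open>x\<close>, so that \<open>e\<close> is a
  sum of eigenvectors \<open>c \<nu>\<close> in that span. Multiplication by \<open>c \<mu>\<close> commutes with multiplication by
  \<open>x\<close>, so \<open>c \<nu> \<odot> c \<mu>\<close> is an eigenvector for both \<open>\<nu>\<close> and \<open>\<mu>\<close>, and is \<open>0\<close> unless \<open>\<nu> = \<mu>\<close>. Then
  \<open>c \<nu> = c \<nu> \<odot> e = c \<nu> \<odot> c \<nu>\<close>.
\<close>
lemma spectral_decomposition:
  obtains \<Lambda> c where "spectral_family x \<Lambda> c"
proof -
  define A where "A = span (range (jordan_power x))"
  have inv: "x \<odot> a \<in> A" if "a \<in> A" for a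
  proof -
    have "(\<odot>) x ` range (jordan_power x) \<subseteq> range (jordan_power x)"
      by (force simp: jordan_power_def intro: range_eqI[of _ _ "Suc _"])
    then have "(\<odot>) x ` A \<subseteq> A"
      unfolding A_def linear_span_image[OF linear_jp, symmetric] by (rule span_mono)
    then show ?thesis using that by blast
  qed
  have "e \<in> A"
    unfolding A_def by (intro span_base range_eqI[of _ _ 0]) (simp add: jordan_power_def)
  then obtain \<Lambda>' c where c': "finite \<Lambda>'" "\<forall>\<nu>\<in>\<Lambda>'. c \<nu> \<in> A \<and> x \<odot> c \<nu> = \<nu> *\<^sub>R c \<nu>"
    "e = (\<Sum>\<nu>\<in>\<Lambda>'. c \<nu>)"
    using selfadjoint_eigenvector_sum[OF linear_jp[of x], of A e] inv jp_associative_inner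
    by (auto simp: A_def)
  define \<Lambda> where "\<Lambda> = {\<nu> \<in> \<Lambda>'. c \<nu> \<noteq> 0}"
  have fin: "finite \<Lambda>" using c' by (simp add: \<Lambda>_def)
  have e: "e = (\<Sum>\<nu>\<in>\<Lambda>. c \<nu>)"
    unfolding c'(3) \<Lambda>_def using c'(1) by (intro sum.mono_neutral_right) auto
  have eig: "x \<odot> c \<nu> = \<nu> *\<^sub>R c \<nu>" and cA: "c \<nu> \<in> A" if "\<nu> \<in> \<Lambda>" for \<nu>
    using c'(2) that by (auto simp: \<Lambda>_def)
  have prod: "x \<odot> (c \<mu> \<odot> c \<nu>) = \<nu> *\<^sub>R (c \<mu> \<odot> c \<nu>)" if "\<nu> \<in> \<Lambda>" "\<mu> \<in> \<Lambda>" for \<nu> \<mu>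
    using operator_commute_span_powers[of "c \<mu>" x] cA[OF that(2)] eig[OF that(1)]
    by (simp add: A_def operator_commute_def jp_distribs)
  have orth: "c \<nu> \<odot> c \<mu> = 0" if "\<nu> \<in> \<Lambda>" "\<mu> \<in> \<Lambda>" "\<nu> \<noteq> \<mu>" for \<nu> \<mu>
  proof -
    have "\<nu> *\<^sub>R (c \<mu> \<odot> c \<nu>) = \<mu> *\<^sub>R (c \<mu> \<odot> c \<nu>)"
      using prod[of \<nu> \<mu>] prod[of \<mu> \<nu>] that by (metis jp_commute)
    then show ?thesis using that by (metis jp_commute scaleR_right_imp_eq)
  qed
  have idem: "c \<nu> \<odot> c \<nu> = c \<nu>" if "\<nu> \<in> \<Lambda>" for \<nu>
  proof -
    have "c \<nu> = c \<nu> \<odot> (\<Sum>\<mu>\<in>\<Lambda>. c \<mu>)" by (simp flip: e)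
    also have "\<dots> = (\<Sum>\<mu>\<in>\<Lambda>. c \<nu> \<odot> c \<mu>)" by (simp add: linear_sum[OF linear_jp])
    also have "\<dots> = (\<Sum>\<mu>\<in>\<Lambda>. if \<mu> = \<nu> then c \<nu> \<odot> c \<nu> else 0)"
      using orth that by (intro sum.cong) auto
    also have "\<dots> = c \<nu> \<odot> c \<nu>" using fin that by simp
    finally show ?thesis by simp
  qed
  have "x = x \<odot> (\<Sum>\<nu>\<in>\<Lambda>. c \<nu>)" by (simp flip: e)
  also have "\<dots> = (\<Sum>\<nu>\<in>\<Lambda>. \<nu> *\<^sub>R c \<nu>)" by (simp add: linear_sum[OF linear_jp] eig)
  finally have "x = (\<Sum>\<nu>\<in>\<Lambda>. \<nu> *\<^sub>R c \<nu>)" .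
  moreover have "c \<nu> \<noteq> 0" if "\<nu> \<in> \<Lambda>" for \<nu>
    using that by (simp add: \<Lambda>_def)
  ultimately have "spectral_family x \<Lambda> c"
    unfolding spectral_family_def using fin idem eig orth e by (intro conjI ballI impI; assumption?)
  then show ?thesis by (rule that)
qed

lemma orthogonal_idempotents_mult:
  assumes "finite \<Lambda>" "\<And>\<nu>. \<nu> \<in> \<Lambda> \<Longrightarrow> c \<nu> \<odot> c \<nu> = c \<nu>"
    and "\<And>\<nu> \<mu>. \<nu> \<in> \<Lambda> \<Longrightarrow> \<mu> \<in> \<Lambda> \<Longrightarrow> \<nu> \<noteq> \<mu> \<Longrightarrow> c \<nu> \<odot> c \<mu> = 0"
  shows "(\<Sum>\<nu>\<in>\<Lambda>. r \<nu> *\<^sub>R c \<nu>) \<odot> (\<Sum>\<nu>\<in>\<Lambda>. s \<nu> *\<^sub>R c \<nu>) = (\<Sum>\<nu>\<in>\<Lambda>. (r \<nu> * s \<nu>) *\<^sub>R c \<nu>)"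
proof -
  have "(\<Sum>\<nu>\<in>\<Lambda>. r \<nu> *\<^sub>R c \<nu>) \<odot> (\<Sum>\<mu>\<in>\<Lambda>. s \<mu> *\<^sub>R c \<mu>)
      = (\<Sum>\<nu>\<in>\<Lambda>. \<Sum>\<mu>\<in>\<Lambda>. (r \<nu> * s \<mu>) *\<^sub>R (c \<nu> \<odot> c \<mu>))"
    by (simp only: linear_sum[OF linear_jp_left])
      (simp only: linear_sum[OF linear_jp] jp_distribs scaleR_scaleR mult.commute)
  also have "\<dots> = (\<Sum>\<nu>\<in>\<Lambda>. \<Sum>\<mu>\<in>\<Lambda>. if \<mu> = \<nu> then (r \<nu> * s \<nu>) *\<^sub>R c \<nu> else 0)"
    using assms by (intro sum.cong refl) auto
  also have "\<dots> = (\<Sum>\<nu>\<in>\<Lambda>. (r \<nu> * s \<nu>) *\<^sub>R c \<nu>)"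
    using assms(1) by simp
  finally show ?thesis .
qed

section \<open>The cone of squares\<close>

lemma square_in_K: "x \<odot> x \<in> K"
  by (auto simp: symmetric_cone_def)

lemma idempotent_in_K: "c \<odot> c = c \<Longrightarrow> c \<in> K"
  using square_in_K[of c] by simp

lemma e_in_K: "e \<in> K"
  by (simp add: idempotent_in_K)

lemma e_nonzero: "e \<noteq> 0"
proof
  assume "e = 0"
  then have "x = 0" for x :: 'a using jp_unit[of x] by (simp add: jp_distribs)
  then show False using nonzero_Basis SOME_Basis by metis
qed

lemma nonneg_combination_in_K:
  assumes "finite \<Lambda>" "\<And>\<nu>. \<nu> \<in> \<Lambda> \<Longrightarrow> c \<nu> \<odot> c \<nu> = c \<nu>"
    and "\<And>\<nu> \<mu>. \<nu> \<in> \<Lambda> \<Longrightarrow> \<mu> \<in> \<Lambda> \<Longrightarrow> \<nu> \<noteq> \<mu> \<Longrightarrow> c \<nu> \<odot> c \<mu> = 0"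
    and "\<And>\<nu>. \<nu> \<in> \<Lambda> \<Longrightarrow> r \<nu> \<ge> 0"
  shows "(\<Sum>\<nu>\<in>\<Lambda>. r \<nu> *\<^sub>R c \<nu>) \<in> K"
proof -
  have "(\<Sum>\<nu>\<in>\<Lambda>. sqrt (r \<nu>) *\<^sub>R c \<nu>) \<odot> (\<Sum>\<nu>\<in>\<Lambda>. sqrt (r \<nu>) *\<^sub>R c \<nu>) = (\<Sum>\<nu>\<in>\<Lambda>. r \<nu> *\<^sub>R c \<nu>)"
    using assms by (simp add: orthogonal_idempotents_mult)
  then show ?thesis using square_in_K by metis
qed

text \<open>
  Let \<open>L\<close> be multiplication by \<open>c\<close>. The triple product formula for \<open>c \<odot> (c \<odot> c)\<close> gives
  \<open>L = 3 L\<^sup>2 - 2 L\<^sup>3\<close>, so the spectrum of \<open>L\<close> lies in \<open>{0, 1/2, 1}\<close>. On these three numbers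
  \<open>\<nu> = \<nu>\<^sup>2 + 4 (\<nu> - \<nu>\<^sup>2)\<^sup>2\<close>, which writes \<open>L\<close> as a sum of squares of self-adjoint operators.
\<close>
lemma idempotent_operator_psd:
  assumes c: "c \<odot> c = c"
  shows "inner (c \<odot> x) x \<ge> 0"
proof -
  define L where "L = (\<odot>) c"
  have L3: "2 *\<^sub>R L (L (L z)) = 3 *\<^sub>R L (L z) - L z" for z
  proof -
    have "L z = L (L z) + L (L z) + L (L z) - L (L (L z)) - L (L (L z))"
      using triple_product_operator[of c c c z] by (simp add: c L_def)
    moreover have "3 *\<^sub>R L (L z) = L (L z) + L (L z) + L (L z)"
      using scaleR_left.add[of 2 1 "L (L z)"] by (simp add: scaleR_2)
    ultimately show ?thesis by (simp add: scaleR_2 algebra_simps)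
  qed
  have L_inner: "inner (L a) b = inner a (L b)" for a b
    by (simp add: L_def jp_associative_inner)
  have L_lin: "L (a - b) = L a - L b" "L (r *\<^sub>R a) = r *\<^sub>R L a" for a b r
    by (simp_all add: L_def jp_distribs)
  define p1 where "p1 = inner x (L x)"
  define p2 where "p2 = inner x (L (L x))"
  define p3 where "p3 = inner x (L (L (L x)))"
  define p4 where "p4 = inner x (L (L (L (L x))))"
  have "2 * p3 = 3 * p2 - p1"
    using arg_cong[OF L3[of x], of "inner x"]
    by (simp add: p1_def p2_def p3_def inner_diff_right)
  moreover have "2 * p4 = 3 * p3 - p2"
    using arg_cong[OF L3[of "L x"], of "inner x"]
    by (simp add: p4_def p2_def p3_def inner_diff_right)
  moreover have "inner (L x) (L x) = p2" by (simp add: L_inner p2_def)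
  moreover have "inner (L x - L (L x)) (L x - L (L x)) = p2 - 2 * p3 + p4"
    by (simp add: L_inner L_lin p2_def p3_def p4_def inner_diff)
  ultimately have "p1 = inner (L x) (L x) + 4 * inner (L x - L (L x)) (L x - L (L x))"
    by linarith
  then have "p1 \<ge> 0" by simp
  then show ?thesis by (simp add: p1_def L_def inner_commute)
qed

text \<open>
  Pairing a square \<open>a \<odot> a\<close> with an idempotent \<open>c\<close> gives \<open>\<langle>c \<odot> a, a\<rangle> \<ge> 0\<close>, and every square is a
  nonnegative combination of idempotents. Conversely, an element of the dual cone has nonnegative
  eigenvalues, as its pairing with each spectral idempotent shows.
\<close>
lemma self_dual: "x \<in> K \<longleftrightarrow> (\<forall>y\<in>K. inner x y \<ge> 0)"
proof
  assume "x \<in> K"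
  then obtain a where x: "x = a \<odot> a" by (auto simp: symmetric_cone_def)
  show "\<forall>y\<in>K. inner x y \<ge> 0"
  proof
    fix y assume "y \<in> K"
    then obtain b where y: "y = b \<odot> b" by (auto simp: symmetric_cone_def)
    obtain \<Lambda> c where "spectral_family b \<Lambda> c"
      by (rule spectral_decomposition)
    note c = spectral_familyD[OF this]
    have "y = (\<Sum>\<nu>\<in>\<Lambda>. (\<nu> * \<nu>) *\<^sub>R c \<nu>)"
      unfolding y c(7) by (rule orthogonal_idempotents_mult) (use c in auto)
    then have "inner x y = (\<Sum>\<nu>\<in>\<Lambda>. (\<nu> * \<nu>) * inner x (c \<nu>))"
      by (simp add: inner_sum_right)
    moreover have "inner x (c \<nu>) \<ge> 0" if "\<nu> \<in> \<Lambda>" for \<nu>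
    proof -
      have "inner x (c \<nu>) = inner a (a \<odot> c \<nu>)" unfolding x by (rule inner_jp_swap)
      also have "\<dots> = inner (c \<nu> \<odot> a) a" by (simp only: jp_commute[of a] inner_commute[of a])
      finally show ?thesis using idempotent_operator_psd[OF c(3)[OF that]] by simp
    qed
    ultimately show "inner x y \<ge> 0" by (simp add: sum_nonneg)
  qed
next
  assume dual: "\<forall>y\<in>K. inner x y \<ge> 0"
  obtain \<Lambda> c where "spectral_family x \<Lambda> c"
    by (rule spectral_decomposition)
  note c = spectral_familyD[OF this]
  have "\<nu> \<ge> 0" if "\<nu> \<in> \<Lambda>" for \<nu>
  proof -
    have "inner x (c \<nu>) = inner (x \<odot> c \<nu>) (c \<nu>)"
      using c(3)[OF that] by (simp add: inner_jp_swap)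
    also have "\<dots> = \<nu> * inner (c \<nu>) (c \<nu>)" by (simp add: c(4)[OF that])
    finally have "\<nu> * inner (c \<nu>) (c \<nu>) \<ge> 0"
      using dual idempotent_in_K[OF c(3)[OF that]] by metis
    moreover have "inner (c \<nu>) (c \<nu>) > 0" using c(2)[OF that] by simp
    ultimately show ?thesis by (simp add: zero_le_mult_iff)
  qed
  then show "x \<in> K"
    unfolding c(7) by (intro nonneg_combination_in_K) (use c in auto)
qed

lemma K_inner_nonneg: "x \<in> K \<Longrightarrow> y \<in> K \<Longrightarrow> inner x y \<ge> 0"
  using self_dual by blast

lemma K_add: "x \<in> K \<Longrightarrow> y \<in> K \<Longrightarrow> x + y \<in> K"
  by (subst self_dual) (simp add: inner_add_left K_inner_nonneg)

lemma K_scale: "x \<in> K \<Longrightarrow> t \<ge> 0 \<Longrightarrow> t *\<^sub>R x \<in> K"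
  by (subst self_dual) (simp add: K_inner_nonneg)

lemma inner_unit_pos:
  assumes "x \<in> K" "x \<noteq> 0"
  shows "inner x e > 0"
proof -
  obtain a where x: "x = a \<odot> a" using assms by (auto simp: symmetric_cone_def)
  then have "a \<noteq> 0" using assms(2) by (auto simp: jp_distribs)
  then show ?thesis by (simp add: x inner_square_unit)
qed

lemma least_eigenvalue:
  obtains \<mu> c where "c \<odot> c = c" "c \<noteq> 0" "u \<odot> c = \<mu> *\<^sub>R c"
    "u - \<mu> *\<^sub>R e \<in> K" "inner (u - \<mu> *\<^sub>R e) c = 0"
proof -
  obtain \<Lambda> c where "spectral_family u \<Lambda> c"
    by (rule spectral_decomposition)
  note c = spectral_familyD[OF this]
  have "\<Lambda> \<noteq> {}" using c(6) e_nonzero by auto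
  define \<mu> where "\<mu> = Min \<Lambda>"
  have \<mu>: "\<mu> \<in> \<Lambda>" "\<And>\<nu>. \<nu> \<in> \<Lambda> \<Longrightarrow> \<mu> \<le> \<nu>"
    using c(1) \<open>\<Lambda> \<noteq> {}\<close> by (auto simp: \<mu>_def)
  have "u - \<mu> *\<^sub>R e = (\<Sum>\<nu>\<in>\<Lambda>. (\<nu> - \<mu>) *\<^sub>R c \<nu>)"
    by (subst c(7), subst c(6)) (simp add: scaleR_sum_right scaleR_diff_left sum_subtractf)
  then have "u - \<mu> *\<^sub>R e \<in> K"
    using nonneg_combination_in_K[of \<Lambda> c "\<lambda>\<nu>. \<nu> - \<mu>"] c \<mu> by simp
  moreover have "inner (u - \<mu> *\<^sub>R e) (c \<mu>) = inner ((u - \<mu> *\<^sub>R e) \<odot> c \<mu>) (c \<mu>)"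
    by (simp add: inner_jp_swap c(3)[OF \<mu>(1)])
  ultimately show ?thesis
    using that[of "c \<mu>" \<mu>] c(2-4)[OF \<mu>(1)] by (simp add: jp_distribs jp_unit)
qed

lemma nonneg_bound_by_unit:
  obtains t where "t \<ge> 0" "t *\<^sub>R e - x \<in> K"
proof -
  obtain \<mu> where "- x - \<mu> *\<^sub>R e \<in> K" using least_eigenvalue[of "- x"] by metis
  moreover have "(\<bar>\<mu>\<bar> + \<mu>) *\<^sub>R e \<in> K" using K_scale[OF e_in_K] by simp
  ultimately have "(- x - \<mu> *\<^sub>R e) + (\<bar>\<mu>\<bar> + \<mu>) *\<^sub>R e \<in> K" by (rule K_add)
  then have "\<bar>\<mu>\<bar> *\<^sub>R e - x \<in> K" by (simp add: algebra_simps)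
  then show ?thesis using that[of "\<bar>\<mu>\<bar>"] by simp
qed

text \<open>
  Multiplication by \<open>x - a e\<close> has small norm when \<open>x\<close> is close to \<open>a e\<close>, so the least eigenvalue of
  \<open>x\<close> is close to \<open>a\<close>.
\<close>
lemma positive_multiple_of_unit_interior:
  assumes "a > 0"
  shows "a *\<^sub>R e \<in> interior K"
proof -
  obtain B where B: "B > 0" "\<And>x y. norm (x \<odot> y) \<le> B * norm x * norm y"
    using bilinear_bounded_pos[OF jp_bilinear] by blast
  have "ball (a *\<^sub>R e) (a / B) \<subseteq> K"
  proof
    fix x assume "x \<in> ball (a *\<^sub>R e) (a / B)"
    then have x: "B * norm (x - a *\<^sub>R e) < a"
      using B(1) by (simp add: dist_norm norm_minus_commute field_simps)
    obtain \<mu> c where c: "c \<noteq> 0" "x \<odot> c = \<mu> *\<^sub>R c" "x - \<mu> *\<^sub>R e \<in> K"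
      using least_eigenvalue[of x] by metis
    have "(x - a *\<^sub>R e) \<odot> c = (\<mu> - a) *\<^sub>R c"
      using c(2) by (simp add: jp_distribs jp_unit scaleR_diff_left)
    then have "\<bar>\<mu> - a\<bar> * norm c \<le> B * norm (x - a *\<^sub>R e) * norm c"
      using B(2)[of "x - a *\<^sub>R e" c] by simp
    then have "\<bar>\<mu> - a\<bar> \<le> B * norm (x - a *\<^sub>R e)" using c(1) by simp
    then have "\<mu> \<ge> 0" using x by linarith
    then show "x \<in> K"
      using K_add[OF c(3) K_scale[OF e_in_K]] by fastforce
  qed
  then show ?thesis
    using assms B(1) by (meson centre_in_ball divide_pos_pos interiorI open_ball)
qed

lemma interior_inner_pos:
  assumes x: "x \<in> interior K" and y: "y \<in> K" "y \<noteq> 0"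
  shows "inner x y > 0"
proof -
  obtain r where r: "r > 0" "cball x r \<subseteq> K" using x by (auto simp: mem_interior_cball)
  then have "x - (r / norm y) *\<^sub>R y \<in> K" using y by (intro subsetD[OF r(2)]) (simp add: dist_norm)
  then have "inner (x - (r / norm y) *\<^sub>R y) y \<ge> 0" using y K_inner_nonneg by blast
  moreover have "(r / norm y) * inner y y > 0" using r y by simp
  ultimately show ?thesis by (simp add: inner_diff_left)
qed

end

section \<open>Skew-symmetric Z-transformations\<close>

locale skew_Z_transformation = euclidean_jordan_algebra +
  fixes D :: "'a \<Rightarrow> 'a"
  assumes Z: "Z_transformation (symmetric_cone (\<odot>)) D"
    and skew: "inner (D x) y = - inner x (D y)"
begin

lemma linear_D: "linear D"
  using Z by (simp add: Z_transformation_def)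

lemmas D_simps = linear_add[OF linear_D] linear_diff[OF linear_D] linear_scale[OF linear_D]
  linear_0[OF linear_D]

lemma Z_property: "x \<in> K \<Longrightarrow> y \<in> K \<Longrightarrow> inner x y = 0 \<Longrightarrow> inner (D x) y \<le> 0"
  using Z by (simp add: Z_transformation_def)

lemma inner_D_self: "inner (D x) x = 0"
  using skew[of x x] by (simp add: inner_commute)

text \<open>
  The pairs \<open>c\<close>, \<open>e - c\<close> and \<open>e - c\<close>, \<open>c\<close> are both subject to the \<open>Z\<close>-property. Since
  \<open>\<langle>D c, c\<rangle> = 0\<close>, they bound \<open>\<langle>D e, c\<rangle>\<close> by \<open>0\<close> from below and from above.
\<close>
lemma D_unit_orthogonal_idempotent:
  assumes c: "c \<odot> c = c"
  shows "inner (D e) c = 0"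
proof -
  have "(e - c) \<odot> (e - c) = e - c" by (simp add: jp_distribs jp_unit c)
  then have K: "c \<in> K" "e - c \<in> K" using c idempotent_in_K by blast+
  have "inner c (e - c) = 0"
    using inner_square_unit[of c] by (simp add: inner_diff_right c)
  then have "inner (D c) (e - c) \<le> 0" "inner (D (e - c)) c \<le> 0"
    using Z_property[OF K] Z_property[OF K(2,1)] by (simp_all add: inner_commute[of "e - c"])
  then show ?thesis
    using skew[of c e] inner_D_self[of c]
    by (simp add: D_simps inner_diff inner_commute)
qed

lemma D_unit: "D e = 0"
proof -
  obtain \<Lambda> c where "spectral_family (D e) \<Lambda> c"
    by (rule spectral_decomposition)
  note c = spectral_familyD[OF this]
  have "inner (D e) (D e) = (\<Sum>\<nu>\<in>\<Lambda>. \<nu> * inner (D e) (c \<nu>))"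
    by (subst (2) c(7)) (simp add: inner_sum_right)
  also have "\<dots> = 0" using c(3) by (simp add: D_unit_orthogonal_idempotent)
  finally show ?thesis by simp
qed

lemma kernel_dim_1_iff: "dim {x. D x = 0} = 1 \<longleftrightarrow> {x. D x = 0} \<subseteq> span {e}"
proof -
  have sub: "subspace {x. D x = 0}" by (auto simp: subspace_def D_simps)
  have "span {e} \<subseteq> {x. D x = 0}" by (rule span_minimal) (simp_all add: sub D_unit)
  moreover have "dim (span {e}) = 1"
    using e_nonzero by (simp only: dim_span) (simp add: dim_insert)
  ultimately show ?thesis
    using subspace_dim_equal[OF subspace_span sub, of "{e}"] by (metis order.refl subset_antisym)
qed

text \<open>
  If the least eigenvalue \<open>\<mu>\<close> of \<open>q\<close> were negative, pairing \<open>q + D q\<close> with the corresponding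
  idempotent would give a negative number: \<open>\<langle>q, c\<rangle>\<close> is a positive multiple of \<open>\<mu>\<close>, and
  \<open>\<langle>D q, c\<rangle> = \<langle>D (q - \<mu> e), c\<rangle> \<le> 0\<close> by the \<open>Z\<close>-property.
\<close>
lemma resolvent_nonneg:
  assumes q: "q + D q \<in> K"
  shows "q \<in> K"
proof -
  obtain \<mu> c where c: "c \<odot> c = c" "c \<noteq> 0" "q - \<mu> *\<^sub>R e \<in> K" "inner (q - \<mu> *\<^sub>R e) c = 0"
    using least_eigenvalue[of q] by metis
  have cK: "c \<in> K" using c(1) by (rule idempotent_in_K)
  have "inner (D q) c \<le> 0"
    using Z_property[OF c(3) cK c(4)] by (simp add: D_simps D_unit)
  moreover have "inner q c = \<mu> * inner c e"
    using c(4) by (simp add: inner_diff_left inner_commute[of c])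
  moreover have "inner (q + D q) c \<ge> 0" using q cK by (rule K_inner_nonneg)
  ultimately have "\<mu> * inner c e \<ge> 0" by (simp add: inner_add_left)
  then have "\<mu> \<ge> 0" using inner_unit_pos[OF cK c(2)] by (simp add: zero_le_mult_iff)
  then show ?thesis using K_add[OF c(3) K_scale[OF e_in_K]] by fastforce
qed

lemma id_plus_D:
  shows "linear (\<lambda>x. x + D x)" and "inj (\<lambda>x. x + D x)" and "surj (\<lambda>x. x + D x)"
proof -
  show lin: "linear (\<lambda>x. x + D x)"
    by (rule linearI) (simp_all add: D_simps algebra_simps)
  have "x = 0" if "x + D x = 0" for x
  proof -
    have "inner (x + D x) x = inner x x" by (simp add: inner_add_left inner_D_self)
    then show ?thesis using that by simp
  qed
  then show inj: "inj (\<lambda>x. x + D x)" using lin linear_injective_0 by blast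
  show "surj (\<lambda>x. x + D x)" using lin inj by (rule linear_injective_imp_surjective) simp
qed

text \<open>
  Subtract from some \<open>u\<close> in the kernel, outside the line through \<open>e\<close>, its least eigenvalue times
  \<open>e\<close>. The element \<open>c\<close> certifies that the resulting \<open>x\<close> lies on the boundary of \<open>K\<close>.
\<close>
lemma boundary_point_in_kernel:
  assumes "\<not> {x. D x = 0} \<subseteq> span {e}"
  obtains x c where "x \<in> K" "x \<noteq> 0" "D x = 0" "c \<in> K" "c \<noteq> 0" "inner x c = 0"
proof -
  obtain u where u: "D u = 0" "u \<notin> span {e}" using assms by blast
  obtain \<mu> c where c: "c \<odot> c = c" "c \<noteq> 0" "u - \<mu> *\<^sub>R e \<in> K" "inner (u - \<mu> *\<^sub>R e) c = 0"
    using least_eigenvalue[of u] by metis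
  have "u - \<mu> *\<^sub>R e \<noteq> 0" using u(2) by (auto simp: span_singleton)
  moreover have "D (u - \<mu> *\<^sub>R e) = 0" by (simp add: D_simps u(1) D_unit)
  ultimately show ?thesis using that c idempotent_in_K by blast
qed

section \<open>Optimal strategies and the kernel\<close>

lemma kernel_strategies_optimal:
  assumes "x \<in> strategies K e" "y \<in> strategies K e" "D x = 0" "D y = 0"
  shows "optimal_strategy_pair K D e x y"
  using assms by (simp add: optimal_strategy_pair_def skew)

text \<open>
  The normalised unit, played against \<open>x0\<close> and \<open>y0\<close>, shows that the value of the game is \<open>0\<close>. Thus
  \<open>D x0\<close> and \<open>D y0\<close> lie in the dual cone \<open>K\<close>; being orthogonal to \<open>e\<close>, they vanish.
\<close>
lemma optimal_strategies_in_kernel: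
  assumes opt: "optimal_strategy_pair K D e x0 y0"
  shows "D x0 = 0" "D y0 = 0"
proof -
  have ee: "inner e e > 0" using e_nonzero by simp
  define s where "s = (1 / inner e e) *\<^sub>R e"
  have s: "s \<in> strategies K e"
    using ee K_scale[OF e_in_K] by (simp add: s_def strategies_def)
  have Ds: "D s = 0" by (simp add: s_def D_simps D_unit)
  have opt1: "inner (D x) y0 \<le> inner (D x0) y0" if "x \<in> strategies K e" for x
    using opt that by (auto simp: optimal_strategy_pair_def)
  have opt2: "inner (D x0) y0 \<le> inner (D x0) y" if "y \<in> strategies K e" for y
    using opt that by (auto simp: optimal_strategy_pair_def)
  have "inner (D x0) s = 0" by (simp add: skew Ds)
  then have v: "inner (D x0) y0 = 0" using opt1[OF s] opt2[OF s] by (simp add: Ds)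
  have normalise: "\<exists>t>0. t *\<^sub>R y \<in> strategies K e" if "y \<in> K" "y \<noteq> 0" for y
    using inner_unit_pos[OF that] K_scale[OF that(1)]
    by (intro exI[of _ "1 / inner y e"]) (simp add: strategies_def)
  have dual_zero: "w = 0"
    if w: "\<And>y. y \<in> strategies K e \<Longrightarrow> inner w y \<ge> 0" "inner w e = 0" for w
  proof -
    have "inner w y \<ge> 0" if "y \<in> K" for y
    proof (cases "y = 0")
      case False
      then obtain t where "t > 0" "t *\<^sub>R y \<in> strategies K e"
        using normalise \<open>y \<in> K\<close> by blast
      then show ?thesis using w(1)[of "t *\<^sub>R y"] by (simp add: zero_le_mult_iff)
    qed simp
    then have "w \<in> K" using self_dual by blast
    then show ?thesis using inner_unit_pos[of w] w(2) by force
  qed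
  show "D x0 = 0"
    by (rule dual_zero) (use opt2 v in \<open>auto simp: skew[of x0 e] D_unit\<close>)
  show "D y0 = 0"
  proof (rule dual_zero)
    show "inner (D y0) y \<ge> 0" if "y \<in> strategies K e" for y
      using opt1[OF that] v skew[of y y0] by (simp add: inner_commute)
  qed (simp add: skew[of y0 e] D_unit)
qed

text \<open>
  An interior point of \<open>K\<close> has a positive inner product with every nonzero element of \<open>K\<close>, so a
  boundary point in the kernel, played by both sides, refutes complete mixedness.
\<close>
lemma completely_mixed_iff_kernel:
  "completely_mixed K D e \<longleftrightarrow> {x. D x = 0} \<subseteq> span {e}"
proof
  assume cm: "completely_mixed K D e"
  show "{x. D x = 0} \<subseteq> span {e}"
  proof (rule ccontr)
    assume "\<not> ?thesis"
    then obtain x c where x: "x \<in> K" "x \<noteq> 0" "D x = 0" "c \<in> K" "c \<noteq> 0" "inner x c = 0"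
      by (rule boundary_point_in_kernel)
    define y where "y = (1 / inner x e) *\<^sub>R x"
    have pos: "inner x e > 0" using x by (simp add: inner_unit_pos)
    then have "y \<in> strategies K e" "D y = 0"
      using x K_scale by (auto simp: y_def strategies_def D_simps)
    then have "y \<in> interior K"
      using cm kernel_strategies_optimal unfolding completely_mixed_def by blast
    then have "inner y c > 0" using x interior_inner_pos by blast
    then show False using x by (simp add: y_def)
  qed
next
  assume ker: "{x. D x = 0} \<subseteq> span {e}"
  have "x \<in> interior K" if x: "x \<in> strategies K e" "D x = 0" for x
  proof -
    obtain a where a: "x = a *\<^sub>R e" using ker x(2) by (auto simp: span_singleton)
    then have "a * inner e e = 1" using x(1) by (simp add: strategies_def)
    then have "a > 0" by (metis inner_ge_zero mult_nonpos_nonneg not_le zero_less_one)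
    then show ?thesis unfolding a by (rule positive_multiple_of_unit_interior)
  qed
  then show "completely_mixed K D e"
    using optimal_strategies_in_kernel
    unfolding completely_mixed_def optimal_strategy_pair_def by blast
qed

section \<open>Invariant faces and the kernel\<close>

text \<open>
  \<open>F\<close> is the face generated by \<open>x\<close>. The resolvent maps it into itself because it preserves \<open>K\<close> and
  fixes \<open>x\<close>; in other words, \<open>F\<close> is contained in \<open>(I + D) F\<close>. The resulting inclusion of its span \<open>W\<close> in \<open>(I + D) W\<close> is an equality because the dimensions agree.
\<close>
lemma kernel_element_generates_invariant_face:
  assumes x: "x \<in> K" "D x = 0"
  defines "F \<equiv> {b \<in> K. \<exists>t\<ge>0. t *\<^sub>R x - b \<in> K}"
  defines "W \<equiv> {a - b | a b. a \<in> F \<and> b \<in> F}"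
  shows "cone_face K F" "D ` W \<subseteq> W" "x \<in> F"
proof -
  have K0: "0 \<in> K" using K_scale[OF e_in_K, of 0] by simp
  have cone: "convex_cone F"
    unfolding convex_cone_iff
  proof (intro conjI ballI allI impI)
    show "0 \<in> F" using K0 by (auto simp: F_def intro!: exI[of _ 0])
  next
    fix a b assume "a \<in> F" "b \<in> F"
    then obtain s t where st: "a \<in> K" "b \<in> K" "s \<ge> 0" "t \<ge> 0" "s *\<^sub>R x - a \<in> K" "t *\<^sub>R x - b \<in> K"
      by (auto simp: F_def)
    have "(s + t) *\<^sub>R x - (a + b) = (s *\<^sub>R x - a) + (t *\<^sub>R x - b)" by (simp add: algebra_simps)
    then have "(s + t) *\<^sub>R x - (a + b) \<in> K" using st K_add by metis
    then show "a + b \<in> F" using st K_add by (auto simp: F_def intro!: exI[of _ "s + t"])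
  next
    fix a r assume "a \<in> F" "(0::real) \<le> r"
    then obtain s where s: "a \<in> K" "s \<ge> 0" "s *\<^sub>R x - a \<in> K" by (auto simp: F_def)
    have "(r * s) *\<^sub>R x - r *\<^sub>R a = r *\<^sub>R (s *\<^sub>R x - a)" by (simp add: algebra_simps)
    then have "(r * s) *\<^sub>R x - r *\<^sub>R a \<in> K" using s \<open>0 \<le> r\<close> K_scale by simp
    then show "r *\<^sub>R a \<in> F"
      using s \<open>0 \<le> r\<close> K_scale by (auto simp: F_def intro!: exI[of _ "r * s"])
  qed
  have summand: "b \<in> F" if bc: "b + c \<in> F" "b \<in> K" "c \<in> K" for b c
  proof -
    obtain t where t: "t \<ge> 0" "t *\<^sub>R x - (b + c) \<in> K" using bc(1) by (auto simp: F_def)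
    have "t *\<^sub>R x - b = (t *\<^sub>R x - (b + c)) + c" by simp
    then have "t *\<^sub>R x - b \<in> K" using K_add[OF t(2) bc(3)] by simp
    then show ?thesis using bc t by (auto simp: F_def)
  qed
  show "cone_face K F"
    unfolding cone_face_def
  proof (intro conjI ballI impI)
    show "F \<subseteq> K" by (auto simp: F_def)
    show "b \<in> F" "c \<in> F" if "a \<in> F" "b \<in> K" "c \<in> K" "a = b + c" for a b c
      using summand[of b c] summand[of c b] that by (simp_all add: add.commute)
  qed (rule cone)
  show "x \<in> F" using x K0 by (auto simp: F_def intro!: exI[of _ 1])
  define T where "T = (\<lambda>x. x + D x)"
  have T: "linear T" "inj T" "surj T" using id_plus_D by (auto simp: T_def)
  have F_sub: "F \<subseteq> T ` F"
  proof
    fix b assume "b \<in> F"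
    then obtain t where b: "b \<in> K" "t \<ge> 0" "t *\<^sub>R x - b \<in> K" by (auto simp: F_def)
    obtain q where q: "b = T q" using T(3) by blast
    have "q \<in> K" by (rule resolvent_nonneg) (use b(1) q in \<open>simp add: T_def\<close>)
    moreover have "T (t *\<^sub>R x - q) \<in> K"
      using b(3) by (simp add: q T_def D_simps x algebra_simps)
    then have "t *\<^sub>R x - q \<in> K" unfolding T_def by (rule resolvent_nonneg)
    ultimately show "b \<in> T ` F" using b q by (auto simp: F_def)
  qed
  have W: "subspace W" unfolding W_def using cone by (rule subspace_differences)
  have "W \<subseteq> T ` W"
  proof
    fix w assume "w \<in> W"
    then obtain a b where "w = a - b" "a \<in> F" "b \<in> F" by (auto simp: W_def)
    then obtain p q where "w = T p - T q" "p \<in> F" "q \<in> F" using F_sub by blast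
    moreover from this have "w = T (p - q)" by (simp add: linear_diff[OF T(1)])
    ultimately show "w \<in> T ` W" unfolding W_def by blast
  qed
  then have "W = T ` W"
    using subspace_dim_equal[OF W linear_subspace_image[OF T(1) W] _ dim_image_le[OF T(1)]]
    by simp
  show "D ` W \<subseteq> W"
  proof
    fix z assume "z \<in> D ` W"
    then obtain w where w: "w \<in> W" "z = D w" by blast
    then have "T w \<in> W" using \<open>W = T ` W\<close> by blast
    then have "T w - w \<in> W" using w W by (simp add: subspace_diff)
    then show "z \<in> W" by (simp add: T_def w)
  qed
qed

text \<open>
  The face generated by a boundary point in the kernel violates irreducibility. For the converse,
  \<open>p\<close> is the projection of \<open>e\<close> on the span \<open>W\<close> of an invariant face. It is a multiple of \<open>e\<close>. If
  it is \<open>0\<close>, then \<open>e\<close> is orthogonal to the face, which is therefore \<open>{0}\<close>; otherwise the face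
  contains \<open>e\<close>, and with it everything dominated by a multiple of \<open>e\<close>, which is all of \<open>K\<close>.
\<close>
lemma space_irreducible_iff_kernel:
  "space_irreducible K D \<longleftrightarrow> {x. D x = 0} \<subseteq> span {e}"
proof
  assume irr: "space_irreducible K D"
  show "{x. D x = 0} \<subseteq> span {e}"
  proof (rule ccontr)
    assume "\<not> ?thesis"
    then obtain x c where x: "x \<in> K" "x \<noteq> 0" "D x = 0" and c: "c \<in> K" "c \<noteq> 0" "inner x c = 0"
      by (rule boundary_point_in_kernel)
    define F where "F = {b \<in> K. \<exists>t\<ge>0. t *\<^sub>R x - b \<in> K}"
    have "F = {0} \<or> F = K" "x \<in> F"
      using irr kernel_element_generates_invariant_face[OF x(1,3)]
      unfolding space_irreducible_def F_def by blast+
    then have "e \<in> F" using x(2) e_in_K by blast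
    then obtain t where "t *\<^sub>R x - e \<in> K" by (auto simp: F_def)
    then have "inner (t *\<^sub>R x - e) c \<ge> 0" using c K_inner_nonneg by blast
    then show False
      using c inner_unit_pos[OF c(1,2)] by (simp add: inner_diff_left inner_commute[of e c])
  qed
next
  assume ker: "{x. D x = 0} \<subseteq> span {e}"
  show "space_irreducible K D"
    unfolding space_irreducible_def
  proof (intro allI impI, elim conjE)
    fix F :: "'a set"
    define W where "W = {a - b | a b. a \<in> F \<and> b \<in> F}"
    assume face: "cone_face K F"
      and "D ` {a - b | a b. a \<in> F \<and> b \<in> F} \<subseteq> {a - b | a b. a \<in> F \<and> b \<in> F}"
    then have inv: "\<And>w. w \<in> W \<Longrightarrow> D w \<in> W" unfolding W_def by blast
    have cone: "convex_cone F" and FK: "F \<subseteq> K"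
      using face unfolding cone_face_def by blast+
    have ideal: "b \<in> F" if "b + c \<in> F" "b \<in> K" "c \<in> K" for b c
      using face that unfolding cone_face_def by blast
    have F0: "0 \<in> F" using cone by (simp add: convex_cone_iff)
    have FW: "F \<subseteq> W" using F0 by (force simp: W_def)
    have W: "subspace W" unfolding W_def using cone by (rule subspace_differences)
    obtain p q where p: "p \<in> W" and q: "\<And>w. w \<in> W \<Longrightarrow> inner q w = 0" and e: "e = p + q"
      using orthogonal_subspace_decomp_exists[of W e] W
      by (metis orthogonal_def span_eq_iff)
    \<comment> \<open>\<open>D p = - D q\<close> lies in \<open>W\<close> and, \<open>D\<close> being skew, also in its orthogonal complement.\<close>
    have "D p = 0"
    proof -
      have "D p + D q = 0" using D_unit unfolding e D_simps .
      then have "D p = - D q" by (simp add: add_eq_0_iff2)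
      then have "inner (D p) (D p) = inner q (D (D p))" using skew[of q "D p"] by simp
      also have "\<dots> = 0" using inv p q by blast
      finally show ?thesis by simp
    qed
    then obtain a where a: "p = a *\<^sub>R e" using ker by (auto simp: span_singleton)
    show "F = {0} \<or> F = K"
    proof (cases "a = 0")
      case True
      then have "e = q" using a e by simp
      have "f = 0" if "f \<in> F" for f
      proof (rule ccontr)
        assume "f \<noteq> 0"
        then have "inner f e > 0" using that FK by (intro inner_unit_pos) auto
        moreover have "inner e f = 0" using that FW q \<open>e = q\<close> by blast
        ultimately show False by (simp add: inner_commute)
      qed
      then show ?thesis using F0 by blast
    next
      case False
      then have "e = (1 / a) *\<^sub>R p" using a by simp
      then have "e \<in> W" using W p subspace_scale by metis
      then obtain f g where "e = f - g" "f \<in> F" "g \<in> F" by (auto simp: W_def)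
      moreover from this have "e + g = f" by simp
      ultimately have eF: "e \<in> F" using ideal[of e g] FK e_in_K by auto
      have "k \<in> F" if "k \<in> K" for k
      proof -
        obtain t where t: "t \<ge> 0" "t *\<^sub>R e - k \<in> K" by (rule nonneg_bound_by_unit)
        then have "k + (t *\<^sub>R e - k) \<in> F" using cone eF by (simp add: convex_cone_iff)
        then show ?thesis using ideal that t by blast
      qed
      then show ?thesis using FK by blast
    qed
  qed
qed

end

theorem theorem4p9:
  fixes jp :: "'a::euclidean_space \<Rightarrow> 'a \<Rightarrow> 'a" and e :: 'a and D :: "'a \<Rightarrow> 'a" and K :: "'a set"
  assumes eja: "euclidean_jordan_algebra jp e"
    and trace_inner: "\<And>x y. inner x y = jtrace jp e (jp x y)"
    and K: "K = symmetric_cone jp"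
    and Z: "Z_transformation K D"
    and skew: "\<And>x. D x + adjoint D x = 0"
  shows "(completely_mixed K D e \<longleftrightarrow> space_irreducible K D) \<and>
         (space_irreducible K D \<longleftrightarrow> dim {x. D x = 0} = 1)"
proof -
  have "linear D" using Z by (simp add: Z_transformation_def)
  then have "inner (D x) y = - inner x (D y)" for x y
    using adjoint_works[of D x y] skew[of y] by (simp add: add_eq_0_iff)
  then interpret skew_Z_transformation jp e D
    using eja Z K by (simp add: skew_Z_transformation_def skew_Z_transformation_axioms_def)
  show ?thesis
    unfolding K
    by (simp only: completely_mixed_iff_kernel space_irreducible_iff_kernel kernel_dim_1_iff)
qed

end
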